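(* Let $s,v,m$ be positive integers and $\epsilon\in\{1,-1\}$, excluding the case $\epsilon=-1$, $vm^2\le4$. Put $d=svm/2$, $k=s^2v(vm^2+4\epsilon)/4$, $\xi=d+\sqrt{k}$, $\bar\xi=d-\sqrt{k}$, and $f_\xi(x)=svm-\epsilon s^2v/x$. If $|\bar\xi|<1/2$, then the pattern continued fraction of $\xi$ is simple (all terms after the first are positive integers), and every iterate $f_\xi^n(\infty)$, $n\ge1$, is a convergent of the simple continued fraction expansion of $\xi$.
   Context: Let $\delta_\epsilon=0$ if $\epsilon=1$ and $\delta_\epsilon=1$ if $\epsilon=-1$. Let $v_n=v$ for even $n$ and $v_n=1$ for odd $n$; $a_0=0$, $a_1=1$, $a_{n+1}=v_nma_n+\epsilon a_{n-1}$. For $n\ge0$ let $s_n=\gcd(a_n,s)$, let $m_n$ be the unique integer with $0\le m_n<s/s_n$ and $m_n(a_n/s_n)\equiv-a_{n-1}\pmod{s/s_n}$ (so $m_0=0$), and $\hat\xi_n=(s_nv_nm-\epsilon m_n)/(s/s_n)$. Every rational has exactly two finite continued fraction expansions $[c_0,\dots,c_r]$ with $c_0\in\mathbb{Z}$, $c_1,\dots,c_r\ge1$, whose lengths differ by one. Let $E_0$ be the expansion of $\hat\xi_0$ and $E_n$ ($n\ge1$) the expansion of $\hat\xi_n-\delta_\epsilon$, each chosen with an odd number of terms if $\epsilon=1$ and an even number if $\epsilon=-1$. The pattern continued fraction of $\xi$ is the infinite continued fraction whose terms are the concatenation $E_0,E_1,E_2,\dots$; it converges to $\xi$, and the value of the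 concatenation $E_0,\dots,E_{n-1}$ is $f_\xi^n(\infty)$.
   Formalization: The sign in f_ξ is corrected to f_ξ(x)=svm+εs²v/x, the map that fixes ξ; with the printed minus sign the claim fails at n=2 (e.g. s=v=1, m=3, ε=1 gives 8/3, not a convergent of (3+√13)/2). *)

theory Defs
  imports Complex_Main "HOL-Library.Stream" "HOL-Number_Theory.Cong"
begin

(* Value of [c0, ..., cr].  No zero denominator is met when c1, ..., cr are all positive. *)
fun cf_value :: "int list \<Rightarrow> real" where
  "cf_value [] = 0"
| "cf_value [c] = of_int c"
| "cf_value (c # cs) = of_int c + 1 / cf_value cs"

definition is_finite_cf :: "int list \<Rightarrow> real \<Rightarrow> bool" where
  "is_finite_cf cs q \<longleftrightarrow>
     cs \<noteq> [] \<and> (\<forall>i. 1 \<le> i \<and> i < length cs \<longrightarrow> cs ! i \<ge> 1) \<and> cf_value cs = q"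

definition simple_cf :: "int stream \<Rightarrow> bool" where
  "simple_cf c \<longleftrightarrow> (\<forall>i\<ge>1. c !! i > 0)"

fun complete_quotient :: "real \<Rightarrow> nat \<Rightarrow> real" where
  "complete_quotient x 0 = x"
| "complete_quotient x (Suc n) = 1 / frac (complete_quotient x n)"

definition cf_term :: "real \<Rightarrow> nat \<Rightarrow> int" where
  "cf_term x n = \<lfloor>complete_quotient x n\<rfloor>"

(* The n-th convergent of the simple continued fraction expansion of x.  For rational x the
   expansion stops; the terms after that are 0 and, as 1 / 0 = 0, do not change the value. *)
definition convergent_of :: "real \<Rightarrow> nat \<Rightarrow> real" where
  "convergent_of x n = cf_value (map (cf_term x) [0..<Suc n])"

definition v_seq :: "int \<Rightarrow> nat \<Rightarrow> int" where
  "v_seq v n = (if even n then v else 1)"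

fun a_seq :: "int \<Rightarrow> int \<Rightarrow> int \<Rightarrow> nat \<Rightarrow> int" where
  "a_seq v m \<epsilon> 0 = 0"
| "a_seq v m \<epsilon> (Suc 0) = 1"
| "a_seq v m \<epsilon> (Suc (Suc n)) = v_seq v (Suc n) * m * a_seq v m \<epsilon> (Suc n) + \<epsilon> * a_seq v m \<epsilon> n"

definition s_seq :: "int \<Rightarrow> int \<Rightarrow> int \<Rightarrow> int \<Rightarrow> nat \<Rightarrow> int" where
  "s_seq s v m \<epsilon> n = gcd (a_seq v m \<epsilon> n) s"

(* For n = 0 the modulus s div s is 1, so the value is 0 whatever is read for the term
   with index n - 1. *)
definition m_seq :: "int \<Rightarrow> int \<Rightarrow> int \<Rightarrow> int \<Rightarrow> nat \<Rightarrow> int" where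
  "m_seq s v m \<epsilon> n =
     (THE x. 0 \<le> x \<and> x < s div s_seq s v m \<epsilon> n \<and>
        [x * (a_seq v m \<epsilon> n div s_seq s v m \<epsilon> n) = - a_seq v m \<epsilon> (n - 1)]
          (mod (s div s_seq s v m \<epsilon> n)))"

definition xi_hat :: "int \<Rightarrow> int \<Rightarrow> int \<Rightarrow> int \<Rightarrow> nat \<Rightarrow> real" where
  "xi_hat s v m \<epsilon> n =
     of_int (s_seq s v m \<epsilon> n * v_seq v n * m - \<epsilon> * m_seq s v m \<epsilon> n) /
     of_int (s div s_seq s v m \<epsilon> n)"

definition delta :: "int \<Rightarrow> real" where
  "delta \<epsilon> = (if \<epsilon> = -1 then 1 else 0)"

definition E_block :: "int \<Rightarrow> int \<Rightarrow> int \<Rightarrow> int \<Rightarrow> nat \<Rightarrow> int list" where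
  "E_block s v m \<epsilon> n =
     (THE cs. is_finite_cf cs (if n = 0 then xi_hat s v m \<epsilon> 0 else xi_hat s v m \<epsilon> n - delta \<epsilon>) \<and>
        (if \<epsilon> = 1 then odd (length cs) else even (length cs)))"

definition pattern_cf :: "int \<Rightarrow> int \<Rightarrow> int \<Rightarrow> int \<Rightarrow> int stream" where
  "pattern_cf s v m \<epsilon> = flat (smap (E_block s v m \<epsilon>) nats)"

(* The Moebius map x |-> svm + eps s^2 v / x on the projective line over the reals, with None
   for the point at infinity.  The sign of the second summand is the one for which xi is a fixed
   point (see f_xi_fixed) and for which the second iterate of infinity, svm + eps s / m, is the
   value of the concatenation E_0, E_1. *)
definition f_xi :: "int \<Rightarrow> int \<Rightarrow> int \<Rightarrow> int \<Rightarrow> real option \<Rightarrow> real option" where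
  "f_xi s v m \<epsilon> x =
     (case x of
        None \<Rightarrow> Some (of_int (s * v * m))
      | Some y \<Rightarrow>
          if y = 0 then None
          else Some (of_int (s * v * m) + of_int (\<epsilon> * s\<^sup>2 * v) / y))"

lemma f_xi_fixed:
  fixes s v m \<epsilon> :: int and x :: real
  assumes pos: "s > 0" "v > 0" "m > 0"
    and k: "0 \<le> of_int (s\<^sup>2 * v * (v * m\<^sup>2 + 4 * \<epsilon>)) / (4 :: real)"
    and x: "x = of_int (s * v * m) / 2 + sqrt (of_int (s\<^sup>2 * v * (v * m\<^sup>2 + 4 * \<epsilon>)) / 4)"
  shows "f_xi s v m \<epsilon> (Some x) = Some x"
proof -
  have "(x - of_int (s * v * m) / 2)\<^sup>2 = of_int (s\<^sup>2 * v * (v * m\<^sup>2 + 4 * \<epsilon>)) / 4"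
    using k x by simp
  then have q: "x * x = of_int (s * v * m) * x + of_int (\<epsilon> * s\<^sup>2 * v)"
    by (simp add: power2_eq_square field_simps)
  have "of_int (s * v * m) > (0 :: real)"
    using pos by simp
  then have "x > 0"
    unfolding x using real_sqrt_ge_zero[OF k] by linarith
  then show ?thesis
    using q by (simp add: f_xi_def field_simps)
qed

end

theory Submission
  imports Defs
begin

text \<open>
  The hypothesis \<open>\<bar>\<xi>'\<bar> < 1/2\<close> amounts to \<open>m \<ge> 2s\<close> if \<open>\<epsilon> = 1\<close> and to \<open>m \<ge> 2s + 1\<close> if
  \<open>\<epsilon> = -1\<close>.  This makes the rationals whose expansions form the blocks after the first one
  larger than 1, so these blocks consist of positive terms.  The n-th iterate of infinity is
  \<open>p/a\<^sub>n\<close> with \<open>p = s v\<^sub>n\<^sub>+\<^sub>1 a\<^sub>n\<^sub>+\<^sub>1\<close>.  The norm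
  \<open>(p - \<xi> a\<^sub>n)(p - \<xi>' a\<^sub>n)\<close> equals \<open>\<plusminus> s\<^sup>2 v\<^sub>n\<^sub>+\<^sub>1\<close>, and the growth of \<open>a\<^sub>n\<close>
  bounds its second factor from below, which yields \<open>0 < a\<^sub>n \<bar>p - \<xi> a\<^sub>n\<bar> < 1/2\<close>.
  Legendre's criterion then shows that \<open>p/a\<^sub>n\<close> is a convergent of \<open>\<xi>\<close>.
\<close>

section \<open>Finite continued fractions\<close>

text \<open>Trades indices for \<open>set (tl cs)\<close>, the form that suits induction over
  lists.\<close>

lemma is_finite_cf_iff:
  "is_finite_cf cs q \<longleftrightarrow> cs \<noteq> [] \<and> (\<forall>c\<in>set (tl cs). 1 \<le> c) \<and> cf_value cs = q"
proof -
  have "(\<forall>i. 1 \<le> i \<and> i < length cs \<longrightarrow> cs ! i \<ge> 1) \<longleftrightarrow> (\<forall>c\<in>set (tl cs). 1 \<le> c)"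
    if ne: "cs \<noteq> []"
  proof -
    obtain c ds where cs: "cs = c # ds"
      using ne by (cases cs) auto
    have "(\<forall>i. 1 \<le> i \<and> i < length cs \<longrightarrow> cs ! i \<ge> 1) \<longleftrightarrow> (\<forall>j<length ds. ds ! j \<ge> 1)"
    proof (intro iffI allI impI)
      fix j assume *: "\<forall>i. 1 \<le> i \<and> i < length cs \<longrightarrow> cs ! i \<ge> 1" and "j < length ds"
      then show "ds ! j \<ge> 1"
        using *[rule_format, of "Suc j"] cs by simp
    next
      fix i assume "\<forall>j<length ds. ds ! j \<ge> 1" "1 \<le> i \<and> i < length cs"
      then show "cs ! i \<ge> 1"
        by (cases i) (auto simp: cs)
    qed
    then show ?thesis
      by (simp add: cs all_set_conv_all_nth)
  qed
  then show ?thesis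
    unfolding is_finite_cf_def by blast
qed

lemma cf_value_Cons: "cs \<noteq> [] \<Longrightarrow> cf_value (c # cs) = of_int c + 1 / cf_value cs"
  by (cases cs) auto

lemma cf_value_ge_one:
  assumes "cs \<noteq> []" and "\<forall>c\<in>set cs. 1 \<le> c"
  shows "1 \<le> cf_value cs"
  using assms
proof (induction cs)
  case (Cons c cs)
  show ?case
  proof (cases "cs = []")
    case False
    then have "1 \<le> cf_value cs" "1 \<le> (of_int c :: real)"
      using Cons by auto
    moreover from this have "0 < 1 / cf_value cs"
      by simp
    ultimately show ?thesis
      unfolding cf_value_Cons[OF False] by linarith
  qed (use Cons in simp)
qed simp

lemma cf_value_gt_one:
  assumes "\<forall>c\<in>set cs. 1 \<le> c" and "2 \<le> length cs"
  shows "1 < cf_value cs"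
proof -
  obtain c ds where cs: "cs = c # ds"
    using assms(2) by (cases cs) auto
  then have ds: "ds \<noteq> []"
    using assms(2) by auto
  then have "1 \<le> cf_value ds" "1 \<le> (of_int c :: real)"
    using assms(1) cs by (auto intro: cf_value_ge_one)
  moreover from this have "0 < 1 / cf_value ds"
    by simp
  ultimately show ?thesis
    unfolding cs cf_value_Cons[OF ds] by linarith
qed

text \<open>The part after the first term adds at most 1 to the value, so a value above 1 forces the
  first term to be positive as well.\<close>

lemma is_finite_cf_pos:
  assumes "is_finite_cf cs q" and "1 < q"
  shows "\<forall>c\<in>set cs. 1 \<le> c"
proof -
  obtain c ds where cs: "cs = c # ds" and ds: "\<forall>c\<in>set ds. 1 \<le> c" and q: "cf_value cs = q"
    using assms(1) unfolding is_finite_cf_iff by (cases cs) auto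
  have "1 \<le> c"
  proof (cases "ds = []")
    case False
    have "1 \<le> cf_value ds"
      using False ds by (rule cf_value_ge_one)
    then have "1 / cf_value ds \<le> 1"
      by simp
    then have "0 < (of_int c :: real)"
      using q assms(2) unfolding cs cf_value_Cons[OF False] by linarith
    then show ?thesis
      by simp
  qed (use q assms(2) cs in auto)
  then show ?thesis
    using cs ds by simp
qed

text \<open>Euclid's algorithm, by induction on the denominator. The parity \<open>b\<close> is
  generalised because each division step flips it.\<close>

lemma finite_cf_exists:
  fixes p q :: int
  assumes "0 < q"
  shows "\<exists>cs. is_finite_cf cs (of_int p / of_int q) \<and> (odd (length cs) \<longleftrightarrow> b)"
  using assms
proof (induction "nat q" arbitrary: p q b rule: less_induct)
  case less
  define c r where "c = p div q" and "r = p mod q"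
  have p: "p = q * c + r" and r: "0 \<le> r" "r < q"
    using less.prems by (simp_all add: c_def r_def)
  show ?case
  proof (cases "r = 0")
    case True
    then have "of_int p / of_int q = (of_int c :: real)"
      using p less.prems by simp
    \<comment> \<open>An integer has one expansion of each parity; this is where the prescribed
      parity is finally met.\<close>
    then have "is_finite_cf [c] (of_int p / of_int q)"
      "is_finite_cf [c - 1, 1] (of_int p / of_int q)"
      by (auto simp: is_finite_cf_iff)
    moreover have "odd (length [c])" "even (length [c - 1, 1])"
      by simp_all
    ultimately show ?thesis
      by (cases b) metis+
  next
    case False
    then have "\<exists>cs. is_finite_cf cs (of_int q / of_int r) \<and> (odd (length cs) \<longleftrightarrow> \<not> b)"
      using r by (intro less.hyps) auto
    then obtain cs where cs: "is_finite_cf cs (of_int q / of_int r)" "odd (length cs) \<longleftrightarrow> \<not> b"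
      by blast
    have "1 < (of_int q / of_int r :: real)"
      using r False by simp
    then have "\<forall>c\<in>set cs. 1 \<le> c"
      using cs(1) is_finite_cf_pos by blast
    moreover have "cs \<noteq> []" "cf_value cs = of_int q / of_int r"
      using cs(1) by (auto simp: is_finite_cf_iff)
    moreover have "of_int c + of_int r / of_int q = (of_int p / of_int q :: real)"
      using less.prems by (simp add: p field_simps)
    ultimately have "is_finite_cf (c # cs) (of_int p / of_int q)"
      by (simp add: is_finite_cf_iff cf_value_Cons)
    then show ?thesis
      using cs(2) by (intro exI[of _ "c # cs"]) auto
  qed
qed

text \<open>The remainders range over \<open>(0, 1]\<close> rather than \<open>[0, 1)\<close>, since
  the tail of a finite expansion may have value 1.\<close>

lemma of_int_add_eq_of_int_add:
  fixes x y :: real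
  assumes "of_int c + x = of_int d + y" and "0 < x" "x \<le> 1" "0 < y" "y \<le> 1"
  shows "c = d"
proof -
  have "of_int (c - d) < (1 :: real)" "- 1 < (of_int (c - d) :: real)"
    using assms by simp_all
  then have "c - d < 1" "-1 < c - d"
    by linarith+
  then show ?thesis
    by simp
qed

text \<open>The only ambiguity, a final \<open>c\<close> against a final \<open>c - 1, 1\<close>,
  changes the parity of the length. For equal parities the first terms agree and can be
  stripped.\<close>

lemma cf_value_inject:
  assumes "cs \<noteq> []" "ds \<noteq> []" "\<forall>c\<in>set (tl cs). 1 \<le> c" "\<forall>d\<in>set (tl ds). 1 \<le> d"
    and "cf_value cs = cf_value ds" and "odd (length cs) \<longleftrightarrow> odd (length ds)"
  shows "cs = ds"
  using assms
proof (induction cs arbitrary: ds)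
  case (Cons c cs)
  obtain d es where ds: "ds = d # es"
    using Cons.prems by (cases ds) auto
  \<comment> \<open>Rules out that exactly one of the tails is empty: the other one then has even
    length, hence at least two terms and a value above 1, whose reciprocal is not an
    integer.\<close>
  have not_int: "of_int a \<noteq> cf_value (b # fs)"
    if "\<forall>f\<in>set fs. 1 \<le> f" "fs \<noteq> []" "even (length fs)" for a b fs
  proof
    assume eq: "of_int a = cf_value (b # fs)"
    have "2 \<le> length fs"
      using that(2,3) by (cases fs; cases "tl fs") auto
    then have "1 < cf_value fs"
      using that(1) by (intro cf_value_gt_one)
    then have "0 < 1 / cf_value fs" "1 / cf_value fs < 1"
      by simp_all
    moreover have "of_int (a - b) = 1 / cf_value fs"
      using eq that(2) by (simp add: cf_value_Cons)
    ultimately have "0 < a - b" "a - b < 1"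
      by (metis of_int_0_less_iff, metis of_int_less_1_iff)
    then show False
      by simp
  qed
  show ?case
  proof (cases "cs = []"; cases "es = []")
    assume "cs \<noteq> []" "es \<noteq> []"
    have ge: "1 \<le> cf_value cs" "1 \<le> cf_value es"
      using Cons.prems ds \<open>cs \<noteq> []\<close> \<open>es \<noteq> []\<close> by (auto intro: cf_value_ge_one)
    have eq: "of_int c + 1 / cf_value cs = of_int d + 1 / cf_value es"
      using Cons.prems(5) ds \<open>cs \<noteq> []\<close> \<open>es \<noteq> []\<close> by (simp add: cf_value_Cons)
    then have "c = d"
      using ge by (intro of_int_add_eq_of_int_add) auto
    with eq have "cf_value cs = cf_value es"
      by simp
    then have "cs = es"
      using Cons.prems ds \<open>cs \<noteq> []\<close> \<open>es \<noteq> []\<close>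
      by (intro Cons.IH) (auto dest: list.set_sel(2))
    then show ?thesis
      using ds \<open>c = d\<close> by simp
  qed (use Cons.prems ds not_int[of es c d] not_int[of cs d c] in auto)
qed simp

text \<open>Makes the definite description in \<open>E_block\<close> meaningful.\<close>

lemma finite_cf_ex1:
  fixes p q :: int
  assumes "0 < q"
  shows "\<exists>!cs. is_finite_cf cs (of_int p / of_int q) \<and> (odd (length cs) \<longleftrightarrow> b)"
proof -
  obtain cs where "is_finite_cf cs (of_int p / of_int q)" "odd (length cs) \<longleftrightarrow> b"
    using finite_cf_exists[OF assms] by blast
  moreover have "ds = cs" if "is_finite_cf ds (of_int p / of_int q)" "odd (length ds) \<longleftrightarrow> b" for ds
    using that calculation unfolding is_finite_cf_iff by (intro cf_value_inject) simp_all
  ultimately show ?thesis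
    by blast
qed

section \<open>Legendre's criterion\<close>

text \<open>The value of the list \<open>cs\<close> followed by a real last entry \<open>w\<close>,
  which plays the role of a complete quotient.\<close>

fun cf_value_end :: "int list \<Rightarrow> real \<Rightarrow> real" where
  "cf_value_end [] w = w"
| "cf_value_end (c # cs) w = of_int c + 1 / cf_value_end cs w"

lemma cf_value_end_gt_one:
  assumes "\<forall>c\<in>set cs. 1 \<le> c" and "1 < w"
  shows "1 < cf_value_end cs w"
  using assms(1)
proof (induction cs)
  case (Cons c cs)
  then have "1 < cf_value_end cs w" "1 \<le> (of_int c :: real)"
    by auto
  moreover from this have "0 < 1 / cf_value_end cs w"
    by simp
  ultimately show ?case
    unfolding cf_value_end.simps by linarith
qed (use assms(2) in simp)

text \<open>The definition unfolds at the last step; unfolding at the first one matches the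
  recursion over lists.\<close>

lemma complete_quotient_Suc: "complete_quotient x (Suc n) = complete_quotient (1 / frac x) n"
  by (induction n) auto

text \<open>As \<open>1 < w\<close>, every tail has a value above 1. So the floor is the head of the
  list, and the reciprocal of the fractional part is the value of the tail.\<close>

lemma cf_term_cf_value_end:
  assumes "\<forall>c\<in>set (tl cs). 1 \<le> c" and "1 < w" and "i < length cs"
  shows "cf_term (cf_value_end cs w) i = cs ! i"
  using assms
proof (induction cs arbitrary: i)
  case (Cons c cs)
  have gt: "1 < cf_value_end cs w"
    using Cons.prems by (intro cf_value_end_gt_one) auto
  then have "0 < 1 / cf_value_end cs w" "1 / cf_value_end cs w < 1"
    by simp_all
  then have floor: "\<lfloor>cf_value_end (c # cs) w\<rfloor> = c"
    by (simp add: floor_eq_iff)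
  then have frac: "1 / frac (cf_value_end (c # cs) w) = cf_value_end cs w"
    by (simp add: frac_def)
  show ?case
  proof (cases i)
    case 0
    then show ?thesis
      using floor by (simp add: cf_term_def)
  next
    case (Suc j)
    have "cf_term (cf_value_end (c # cs) w) i = cf_term (cf_value_end cs w) j"
      unfolding cf_term_def Suc complete_quotient_Suc frac ..
    also have "\<dots> = cs ! j"
      using Cons.prems Suc by (intro Cons.IH) (auto dest: list.set_sel(2)[rotated])
    finally show ?thesis
      using Suc by simp
  qed
qed simp

lemma convergent_of_cf_value_end:
  assumes "cs \<noteq> []" and "\<forall>c\<in>set (tl cs). 1 \<le> c" and "1 < w"
  shows "convergent_of (cf_value_end cs w) (length cs - 1) = cf_value cs"
proof -
  have "map (cf_term (cf_value_end cs w)) [0..<Suc (length cs - 1)] = cs"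
    using assms by (intro nth_equalityI) (auto simp: cf_term_cf_value_end simp del: upt_Suc)
  then show ?thesis
    by (simp add: convergent_of_def del: upt_Suc)
qed

text \<open>\<open>P/Q\<close> and \<open>P'/Q'\<close> are the last two convergents of the list.\<close>

lemma cf_value_moebius:
  assumes "cs \<noteq> []" and "\<forall>c\<in>set (tl cs). 1 \<le> c"
  obtains P P' Q Q' :: int where
    "0 < Q" "0 \<le> Q'" "Q' \<le> Q" "P * Q' - P' * Q = (-1) ^ length cs"
    "cf_value cs = of_int P / of_int Q"
    "\<And>w. 1 < w \<Longrightarrow> cf_value_end cs w = (of_int P * w + of_int P') / (of_int Q * w + of_int Q')"
proof -
  have "\<exists>P P' Q Q' :: int. 0 < Q \<and> 0 \<le> Q' \<and> Q' \<le> Q \<and> P * Q' - P' * Q = (-1) ^ length cs \<and>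
      cf_value cs = of_int P / of_int Q \<and>
      (\<forall>w>1. cf_value_end cs w = (of_int P * w + of_int P') / (of_int Q * w + of_int Q')) \<and>
      (1 \<le> hd cs \<longrightarrow> 0 < P \<and> 0 \<le> P' \<and> P' \<le> P)"
    using assms
  proof (induction cs)
    case (Cons c cs)
    show ?case
    proof (cases "cs = []")
      case True
      \<comment> \<open>The convergent \<open>c/1\<close>, preceded by the formal convergent
        \<open>1/0\<close>.\<close>
      then show ?thesis
        by (intro exI[of _ c] exI[of _ 1] exI[of _ 0]) (auto simp: field_simps)
    next
      case False
      then have pos: "\<forall>c\<in>set cs. 1 \<le> c"
        using Cons.prems by simp
      then have "\<forall>c\<in>set (tl cs). 1 \<le> c" and hd: "1 \<le> hd cs"
        using False by (auto dest: list.set_sel)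
      with Cons.IH False obtain P P' Q Q' :: int where
        Q: "0 < Q" "0 \<le> Q'" "Q' \<le> Q" and det: "P * Q' - P' * Q = (-1) ^ length cs"
        and val: "cf_value cs = of_int P / of_int Q"
        and val_end: "\<And>w. 1 < w \<Longrightarrow>
          cf_value_end cs w = (of_int P * w + of_int P') / (of_int Q * w + of_int Q')"
        and P: "0 < P" "0 \<le> P'" "P' \<le> P"
        by auto
      have "cf_value (c # cs) = of_int (c * P + Q) / of_int P"
        using P by (simp add: cf_value_Cons[OF False] val field_simps)
      moreover have "cf_value_end (c # cs) w =
          (of_int (c * P + Q) * w + of_int (c * P' + Q')) / (of_int P * w + of_int P')"
        if "1 < w" for w
      proof -
        have "0 < of_int P * w + of_int P'"
          using P that by (intro add_pos_nonneg mult_pos_pos) auto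
        then show ?thesis
          using that by (simp add: val_end field_simps)
      qed
      moreover have "(c * P + Q) * P' - (c * P' + Q') * P = (-1) ^ length (c # cs)"
        using det by (simp add: algebra_simps)
      moreover have "0 < c * P + Q \<and> 0 \<le> c * P' + Q' \<and> c * P' + Q' \<le> c * P + Q" if "1 \<le> c"
        using that P Q by (auto intro!: add_pos_pos add_mono mult_left_mono)
      ultimately show ?thesis
        using P by (intro exI[of _ "c * P + Q"] exI[of _ "c * P' + Q'"] exI[of _ P] exI[of _ P'])
          auto
    qed
  qed simp
  then show ?thesis
    using that by blast
qed

text \<open>A real last entry \<open>w\<close> extends an expansion of \<open>p/q\<close> to one of
  \<open>x\<close>. Closeness gives \<open>1 < w\<close>, so the expansion of \<open>p/q\<close> is
  an initial part of that of \<open>x\<close>.\<close>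

theorem Legendre_convergent:
  fixes x :: real and p q :: int
  assumes "0 < q" and ne: "of_int p \<noteq> x * of_int q"
    and close: "of_int q * \<bar>of_int p - x * of_int q\<bar> < 1 / 2"
  shows "\<exists>i. of_int p / of_int q = convergent_of x i"
proof -
  \<comment> \<open>The parity of the length is chosen such that the new last entry below is positive.\<close>
  obtain cs where cs: "is_finite_cf cs (of_int p / of_int q)"
    and parity: "odd (length cs) \<longleftrightarrow> of_int p < x * of_int q"
    using finite_cf_exists[OF assms(1), of p "of_int p < x * of_int q"] by blast
  then have ne': "cs \<noteq> []" and pos: "\<forall>c\<in>set (tl cs). 1 \<le> c"
    by (auto simp: is_finite_cf_iff)
  obtain P P' Q Q' :: int where Q: "0 < Q" "0 \<le> Q'" "Q' \<le> Q"
    and det: "P * Q' - P' * Q = (-1) ^ length cs"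
    and val: "cf_value cs = of_int P / of_int Q"
    and val_end: "\<And>w. 1 < w \<Longrightarrow>
      cf_value_end cs w = (of_int P * w + of_int P') / (of_int Q * w + of_int Q')"
    by (rule cf_value_moebius[OF ne' pos]) (rule that)
  have "of_int p / of_int q = (of_int P / of_int Q :: real)"
    using cs val by (simp add: is_finite_cf_iff)
  then have "of_int (p * Q) = (of_int (P * q) :: real)"
    using Q assms(1) by (simp add: field_simps)
  then have cross: "p * Q = P * q"
    by linarith
  \<comment> \<open>The determinant is 1 or -1, so \<open>P/Q\<close> is in lowest terms, whereas
    \<open>p/q\<close> may have a common factor \<open>g\<close>.\<close>
  have "coprime Q P"
  proof (rule coprimeI)
    fix c assume "c dvd Q" "c dvd P"
    then have "c dvd P * Q' - P' * Q"
      by simp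
    then show "is_unit c"
      unfolding det by (cases "even (length cs)") simp_all
  qed
  moreover have "Q dvd P * q"
    using cross by (metis dvd_triv_right)
  ultimately have "Q dvd q"
    by (simp add: coprime_dvd_mult_right_iff)
  then obtain g where q: "q = Q * g" ..
  have "0 < g"
    using q assms(1) Q by (simp add: zero_less_mult_iff)
  have p: "p = P * g"
    using cross Q by (simp add: q)
  define e where "e = x * of_int Q - of_int P"
  have eg: "x * of_int q - of_int p = of_int g * e"
    by (simp add: e_def p q algebra_simps)
  have "e \<noteq> 0"
    using eg ne by auto
  \<comment> \<open>By the choice of parity, \<open>e\<close> is positive exactly for odd
    length.\<close>
  have sgn: "(-1) ^ length cs * e = - \<bar>e\<bar>"
  proof (cases "odd (length cs)")
    case True
    then have "0 < of_int g * e"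
      using parity eg by linarith
    then have "0 < e"
      using \<open>0 < g\<close> by (simp add: zero_less_mult_iff)
    then show ?thesis
      using True by simp
  next
    case False
    then have "of_int g * e \<le> 0"
      using parity eg by linarith
    then have "e \<le> 0"
      using \<open>0 < g\<close> by (simp add: mult_le_0_iff)
    then show ?thesis
      using False by simp
  qed
  \<comment> \<open>Reducing the fraction divides the product of denominator and error by
    \<open>g * g\<close>, so the bound 1/2 is inherited.\<close>
  have "of_int Q * \<bar>e\<bar> \<le> (of_int g * of_int g) * (of_int Q * \<bar>e\<bar>)"
  proof -
    have "1 \<le> g * g"
      using \<open>0 < g\<close> by (simp add: int_one_le_iff_zero_less)
    then have "1 \<le> (of_int (g * g) :: real)"
      by linarith
    then show ?thesis
      using Q mult_right_mono[of 1 "of_int (g * g)" "of_int Q * \<bar>e\<bar>"] by simp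
  qed
  also have "\<dots> = of_int q * \<bar>of_int p - x * of_int q\<bar>"
    using \<open>0 < g\<close> eg by (subst abs_minus_commute) (simp add: q abs_mult)
  also have "\<dots> < 1 / 2"
    by (fact close)
  finally have small: "of_int Q * \<bar>e\<bar> < 1 / 2" .
  \<comment> \<open>The solution of \<open>(P * w + P') / (Q * w + Q') = x\<close>.\<close>
  define w where "w = (of_int P' - x * of_int Q') / e"
  have detr: "of_int P * of_int Q' - of_int P' * of_int Q = ((-1) ^ length cs :: real)"
    using arg_cong[OF det, of "of_int :: int \<Rightarrow> real"] by simp
  \<comment> \<open>The bound 1/2 enters here: the first term exceeds \<open>2 * Q\<close> and
    \<open>Q' \<le> Q\<close>, which leaves more than \<open>Q\<close>.\<close>
  have "w * of_int Q = 1 / \<bar>e\<bar> - of_int Q'"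
  proof -
    have "(of_int P' - x * of_int Q') * of_int Q = - ((-1) ^ length cs) - of_int Q' * e"
      unfolding detr[symmetric] e_def by (simp add: algebra_simps)
    then have "w * of_int Q = - ((-1) ^ length cs) / e - of_int Q'"
      using \<open>e \<noteq> 0\<close> by (simp add: w_def field_simps)
    also have "- ((-1) ^ length cs) / e = 1 / \<bar>e\<bar>"
      using sgn \<open>e \<noteq> 0\<close> by (cases "even (length cs)") auto
    finally show ?thesis .
  qed
  moreover have "2 * of_int Q < 1 / \<bar>e\<bar>"
    using small \<open>e \<noteq> 0\<close> by (simp add: field_simps)
  moreover have "of_int Q' \<le> (of_int Q :: real)"
    using Q by simp
  ultimately have "1 * of_int Q < w * of_int Q"
    by linarith
  then have w: "1 < w"
    using Q by (simp add: mult_less_cancel_right)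
  have "0 < of_int Q * w + of_int Q'"
    using Q w by (intro add_pos_nonneg mult_pos_pos) auto
  moreover have "w * e = of_int P' - x * of_int Q'"
    using \<open>e \<noteq> 0\<close> by (simp add: w_def)
  then have "of_int P * w + of_int P' = x * (of_int Q * w + of_int Q')"
    unfolding e_def by (simp add: algebra_simps)
  ultimately have "cf_value_end cs w = x"
    by (simp add: val_end[OF w])
  then have "convergent_of x (length cs - 1) = of_int p / of_int q"
    using convergent_of_cf_value_end[OF ne' pos w] cs by (simp add: is_finite_cf_iff)
  then show ?thesis
    by metis
qed

section \<open>The blocks of the pattern\<close>

lemma s_seq_pos: "0 < s \<Longrightarrow> 0 < s_seq s v m \<epsilon> n"
  by (simp add: s_seq_def)

lemma s_seq_quotient:
  assumes "0 < s"
  shows "0 < s div s_seq s v m \<epsilon> n" and "s div s_seq s v m \<epsilon> n \<le> s"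
proof -
  have "s_seq s v m \<epsilon> n dvd s"
    by (simp add: s_seq_def)
  then show "0 < s div s_seq s v m \<epsilon> n"
    using assms s_seq_pos[OF assms] by (simp add: pos_imp_zdiv_pos_iff zdvd_imp_le)
  show "s div s_seq s v m \<epsilon> n \<le> s"
    using assms s_seq_pos[OF assms, of v m \<epsilon> n] by (simp add: int_div_le_self)
qed

text \<open>After division by the gcd, the coefficient of \<open>x\<close> is invertible modulo
  \<open>s div s_seq s v m \<epsilon> n\<close>, so the description in \<open>m_seq\<close> has
  exactly one solution.\<close>

lemma m_seq_bounds:
  assumes "0 < s"
  shows "0 \<le> m_seq s v m \<epsilon> n" and "m_seq s v m \<epsilon> n < s div s_seq s v m \<epsilon> n"
proof -
  define t where "t = s div s_seq s v m \<epsilon> n"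
  define a where "a = a_seq v m \<epsilon> n div s_seq s v m \<epsilon> n"
  have "0 < t"
    unfolding t_def using assms by (rule s_seq_quotient)
  have cop: "coprime a t"
    unfolding a_def t_def s_seq_def using assms by (intro div_gcd_coprime) auto
  then obtain b where b: "[a * b = 1] (mod t)"
    using coprime_iff_invertible_int by blast
  have "\<exists>!x. 0 \<le> x \<and> x < t \<and> [x * a = - a_seq v m \<epsilon> (n - 1)] (mod t)" (is "\<exists>!x. ?P x")
  proof (rule ex1I[of _ "(- a_seq v m \<epsilon> (n - 1) * b) mod t"])
    have "[(- a_seq v m \<epsilon> (n - 1) * b) mod t * a = - a_seq v m \<epsilon> (n - 1) * b * a] (mod t)"
      by (intro cong_mult) (auto simp: cong_def)
    also have "- a_seq v m \<epsilon> (n - 1) * b * a = - a_seq v m \<epsilon> (n - 1) * (a * b)"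
      by simp
    also have "[- a_seq v m \<epsilon> (n - 1) * (a * b) = - a_seq v m \<epsilon> (n - 1) * 1] (mod t)"
      using b by (intro cong_mult) auto
    finally show "?P ((- a_seq v m \<epsilon> (n - 1) * b) mod t)"
      using \<open>0 < t\<close> by simp
    then have *: "[(- a_seq v m \<epsilon> (n - 1) * b) mod t * a = - a_seq v m \<epsilon> (n - 1)] (mod t)"
      by blast
    fix x assume x: "?P x"
    then have "[x * a = (- a_seq v m \<epsilon> (n - 1) * b) mod t * a] (mod t)"
      using * by (meson cong_sym cong_trans)
    then have "[x = (- a_seq v m \<epsilon> (n - 1) * b) mod t] (mod t)"
      using cop by (simp add: cong_mult_rcancel)
    then show "x = (- a_seq v m \<epsilon> (n - 1) * b) mod t"
      using x by (simp add: cong_def)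
  qed
  from theI'[OF this] show "0 \<le> m_seq s v m \<epsilon> n" "m_seq s v m \<epsilon> n < s div s_seq s v m \<epsilon> n"
    unfolding m_seq_def t_def a_def by blast+
qed

text \<open>The denominator \<open>t\<close> is at most \<open>s\<close>, and \<open>m_seq\<close>
  lies in \<open>[0, t)\<close>. For \<open>\<epsilon> = 1\<close> the numerator exceeds
  \<open>2 * s - t\<close>; for \<open>\<epsilon> = -1\<close> it exceeds \<open>2 * s\<close>, and
  subtracting \<open>delta\<close> takes away \<open>t\<close>. Either way more than
  \<open>t\<close> remains.\<close>

lemma xi_hat_gt_one:
  assumes "0 < s" "0 < v" "\<epsilon> = 1 \<and> 2 * s \<le> m \<or> \<epsilon> = -1 \<and> 2 * s < m"
  shows "1 < xi_hat s v m \<epsilon> n - delta \<epsilon>"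
proof -
  define t where "t = s div s_seq s v m \<epsilon> n"
  have t: "0 < t" "t \<le> s"
    unfolding t_def using s_seq_quotient[OF assms(1)] by blast+
  have mn: "0 \<le> m_seq s v m \<epsilon> n" "m_seq s v m \<epsilon> n < t"
    unfolding t_def using m_seq_bounds[OF assms(1)] by blast+
  have "1 \<le> s_seq s v m \<epsilon> n * v_seq v n"
    using s_seq_pos[OF assms(1), of v m \<epsilon> n] assms(2)
    by (simp add: v_seq_def int_one_le_iff_zero_less)
  moreover define M where "M = s_seq s v m \<epsilon> n * v_seq v n * m"
  ultimately have "m \<le> M"
    using assms by (auto simp: mult_le_cancel_right1)
  then have "t < M - \<epsilon> * m_seq s v m \<epsilon> n - (if \<epsilon> = -1 then t else 0)"
    using assms(3) t mn by auto
  then have "(of_int t :: real) <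
      of_int (M - \<epsilon> * m_seq s v m \<epsilon> n - (if \<epsilon> = -1 then t else 0))"
    by linarith
  also have "\<dots> = (xi_hat s v m \<epsilon> n - delta \<epsilon>) * of_int t"
    unfolding xi_hat_def t_def[symmetric] M_def[symmetric]
    using t by (simp add: delta_def field_simps)
  finally show ?thesis
    using t by (simp add: mult_less_cancel_right)
qed

lemma is_finite_cf_E_block:
  assumes "0 < s"
  shows "is_finite_cf (E_block s v m \<epsilon> n)
    (if n = 0 then xi_hat s v m \<epsilon> 0 else xi_hat s v m \<epsilon> n - delta \<epsilon>)" (is "is_finite_cf _ ?x")
proof -
  define t where "t = s div s_seq s v m \<epsilon> n"
  have "0 < t"
    unfolding t_def using s_seq_quotient[OF assms] by blast
  define N where "N = s_seq s v m \<epsilon> n * v_seq v n * m - \<epsilon> * m_seq s v m \<epsilon> n"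
  define p where "p = N - (if n \<noteq> 0 \<and> \<epsilon> = -1 then t else 0)"
  have "xi_hat s v m \<epsilon> n = of_int N / of_int t"
    by (simp add: xi_hat_def N_def t_def)
  then have x: "?x = of_int p / of_int t"
    using \<open>0 < t\<close> by (cases "n = 0") (simp_all add: p_def delta_def diff_divide_distrib)
  have "(if \<epsilon> = 1 then odd (length cs) else even (length cs)) \<longleftrightarrow> (odd (length cs) \<longleftrightarrow> \<epsilon> = 1)"
    for cs :: "int list"
    by auto
  then have "E_block s v m \<epsilon> n =
      (THE cs. is_finite_cf cs (of_int p / of_int t) \<and> (odd (length cs) \<longleftrightarrow> \<epsilon> = 1))"
    unfolding E_block_def x by simp
  then show ?thesis
    unfolding x using theI'[OF finite_cf_ex1[OF \<open>0 < t\<close>]] by simp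
qed

text \<open>Index 0, which \<open>simple_cf\<close> exempts, is the head of \<open>E 0\<close>. This
  block is split off, and all terms beyond it lie in later blocks.\<close>

lemma simple_cf_flat:
  assumes ne: "\<And>n. E n \<noteq> []"
    and first: "\<forall>c\<in>set (tl (E 0)). 0 < c"
    and rest: "\<And>n c. 1 \<le> n \<Longrightarrow> c \<in> set (E n) \<Longrightarrow> 0 < c"
  shows "simple_cf (flat (smap E nats))"
proof -
  have "smap E nats = E 0 ## smap E (fromN 1)"
    by (subst siterate.code) simp
  then have split: "flat (smap E nats) = E 0 @- flat (smap E (fromN 1))"
    using ne by simp
  have sset: "sset (flat (smap E (fromN 1))) = (\<Union>xs\<in>sset (smap E (fromN 1)). set xs)"
    using ne by (intro sset_flat) (auto simp: stream.set_map)
  show ?thesis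
    unfolding simple_cf_def
  proof (intro allI impI)
    fix i :: nat assume "1 \<le> i"
    show "0 < flat (smap E nats) !! i"
    proof (cases "i < length (E 0)")
      case True
      then have "E 0 ! i = tl (E 0) ! (i - 1)" "i - 1 < length (tl (E 0))"
        using \<open>1 \<le> i\<close> by (auto simp: nth_tl)
      then have "E 0 ! i \<in> set (tl (E 0))"
        by simp
      then show ?thesis
        using first True split by simp
    next
      case False
      then have "flat (smap E nats) !! i \<in> sset (flat (smap E (fromN 1)))"
        by (simp add: split snth_sset)
      then obtain n where "1 \<le> n" "flat (smap E nats) !! i \<in> set (E n)"
        unfolding sset by (auto simp: stream.set_map)
      then show ?thesis
        by (rule rest)
    qed
  qed
qed

section \<open>The iterates of infinity\<close>

lemma v_seq_mult_Suc: "v_seq v n * v_seq v (Suc n) = v"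
  by (simp add: v_seq_def)

lemma v_seq_Suc_Suc: "v_seq v (Suc (Suc n)) = v_seq v n"
  by (simp add: v_seq_def)

lemma v_seq_pos: "0 < v \<Longrightarrow> 0 < v_seq v n"
  by (simp add: v_seq_def)

text \<open>The recurrence preserves doubling: for \<open>\<epsilon> = 1\<close> a factor 2
  suffices, for \<open>\<epsilon> = -1\<close> the third copy of the current term covers the
  subtracted one.\<close>

lemma a_seq_growth:
  assumes "0 < v" "2 \<le> m" "\<epsilon> = 1 \<or> \<epsilon> = -1 \<and> 3 \<le> m"
  shows "0 < a_seq v m \<epsilon> (Suc n) \<and> 0 \<le> a_seq v m \<epsilon> n \<and> 2 * a_seq v m \<epsilon> n \<le> a_seq v m \<epsilon> (Suc n)"
proof (induction n)
  case (Suc n)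
  let ?a = "a_seq v m \<epsilon> (Suc n)"
  have "1 \<le> v_seq v (Suc n)"
    using v_seq_pos[OF assms(1), of "Suc n"] by simp
  then have "m \<le> v_seq v (Suc n) * m"
    using assms by (simp add: mult_le_cancel_right1)
  moreover define b where "b = v_seq v (Suc n) * m * ?a"
  ultimately have "m * ?a \<le> b"
    using Suc by (auto intro: mult_right_mono)
  moreover have "2 * ?a \<le> m * ?a" "\<epsilon> = -1 \<longrightarrow> 3 * ?a \<le> m * ?a"
    using Suc assms by (auto intro!: mult_right_mono)
  ultimately have "2 * ?a \<le> b" "\<epsilon> = -1 \<longrightarrow> 3 * ?a \<le> b"
    by linarith+
  moreover have "a_seq v m \<epsilon> (Suc (Suc n)) = b + \<epsilon> * a_seq v m \<epsilon> n"
    by (simp add: b_def)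
  ultimately show ?case
    using Suc assms by (auto simp del: a_seq.simps)
qed simp

text \<open>A Cassini-type identity: each step of the recurrence multiplies the form by
  \<open>- \<epsilon>\<close>. Scaled by \<open>s\<^sup>2 * v_seq v (Suc n)\<close> it becomes the
  norm of \<open>p - \<xi> * q\<close> for the fraction \<open>p/q\<close> of the iterate.\<close>

lemma a_seq_norm:
  assumes "\<epsilon> * \<epsilon> = 1"
  shows "v_seq v (Suc n) * (a_seq v m \<epsilon> (Suc n))\<^sup>2 - v * m * a_seq v m \<epsilon> n * a_seq v m \<epsilon> (Suc n)
    - \<epsilon> * v_seq v n * (a_seq v m \<epsilon> n)\<^sup>2 = (- \<epsilon>) ^ n"
proof (induction n)
  case 0
  show ?case
    by (simp add: v_seq_def)
next
  case (Suc n)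
  define a b u u' where "a = a_seq v m \<epsilon> n" and "b = a_seq v m \<epsilon> (Suc n)"
    and "u = v_seq v n" and "u' = v_seq v (Suc n)"
  have v: "v = u * u'"
    by (simp add: u_def u'_def v_seq_mult_Suc)
  have "u * (u' * m * b + \<epsilon> * a)\<^sup>2 - v * m * b * (u' * m * b + \<epsilon> * a) - \<epsilon> * u' * b\<^sup>2
      = \<epsilon> * v * m * a * b + (\<epsilon> * \<epsilon>) * u * a\<^sup>2 - \<epsilon> * u' * b\<^sup>2"
    unfolding v by (simp add: power2_eq_square algebra_simps)
  also have "\<dots> = (\<epsilon> * \<epsilon>) * u * a\<^sup>2 - \<epsilon> * (u' * b\<^sup>2 - v * m * a * b)"
    by (simp add: algebra_simps)
  also have "u' * b\<^sup>2 - v * m * a * b = (- \<epsilon>) ^ n + \<epsilon> * u * a\<^sup>2"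
    using Suc by (simp add: a_def b_def u_def u'_def)
  finally show ?case
    by (simp add: a_def b_def u_def u'_def v_seq_Suc_Suc algebra_simps)
qed

text \<open>Since \<open>v\<close> is the product of two consecutive values of \<open>v_seq\<close>,
  one application of \<open>f_xi\<close> reproduces the recurrence of \<open>a_seq\<close> in the
  numerator. By periodicity \<open>v_seq v n\<close> stands for
  \<open>v_seq v (Suc (Suc n))\<close>.\<close>

lemma f_xi_iterate:
  assumes "0 < s" "0 < v" and apos: "\<And>n. 0 < a_seq v m \<epsilon> (Suc n)"
  shows "(f_xi s v m \<epsilon> ^^ Suc n) None =
    Some (of_int (s * v_seq v n * a_seq v m \<epsilon> (Suc (Suc n))) / of_int (a_seq v m \<epsilon> (Suc n)))"
proof (induction n)
  case 0
  show ?case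
    by (simp add: f_xi_def v_seq_def)
next
  case (Suc n)
  define a b u u' where "a = a_seq v m \<epsilon> (Suc n)" and "b = a_seq v m \<epsilon> (Suc (Suc n))"
    and "u = v_seq v n" and "u' = v_seq v (Suc n)"
  have pos: "0 < a" "0 < b" "0 < u"
    using apos assms by (simp_all add: a_def b_def u_def v_seq_pos del: a_seq.simps)
  have v: "v = u * u'"
    by (simp add: u_def u'_def v_seq_mult_Suc)
  have rec: "a_seq v m \<epsilon> (Suc (Suc (Suc n))) = u * m * b + \<epsilon> * a"
    by (simp add: a_def b_def u_def v_seq_Suc_Suc)
  have "(f_xi s v m \<epsilon> ^^ Suc (Suc n)) None = f_xi s v m \<epsilon> (Some (of_int (s * u * b) / of_int a))"
    using Suc by (simp add: a_def b_def u_def)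
  also have "\<dots> = Some (of_int (s * v * m) + of_int (\<epsilon> * s\<^sup>2 * v) / (of_int (s * u * b) / of_int a))"
    using pos assms by (simp add: f_xi_def)
  also have "of_int (s * v * m) + of_int (\<epsilon> * s\<^sup>2 * v) / (of_int (s * u * b) / of_int a)
      = (of_int (s * u' * (u * m * b + \<epsilon> * a)) / of_int b :: real)"
    using pos assms(1) by (simp add: v field_simps power2_eq_square)
  finally show ?case
    unfolding rec by (simp add: b_def u'_def)
qed

section \<open>Consequences of a small conjugate\<close>

text \<open>The product turns smallness of \<open>y\<close> into
  \<open>2 * s\<^sup>2 * v < x\<close>. Comparison with the sum and cancellation of
  \<open>s * v\<close> then bound \<open>m\<close>.\<close>

lemma small_conjugate_imp_large_m:
  fixes x y :: real and s v m \<epsilon> :: int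
  assumes "0 < s" "0 < v" and "\<epsilon> = 1 \<or> \<epsilon> = -1" and "0 < x"
    and sum: "x + y = of_int (s * v * m)" and prod: "x * y = - of_int (\<epsilon> * s\<^sup>2 * v)"
    and small: "\<bar>y\<bar> < 1 / 2"
  shows "\<epsilon> = 1 \<and> 2 * s \<le> m \<and> y < 0 \<or> \<epsilon> = -1 \<and> 2 * s < m \<and> 0 < y"
proof -
  have sv: "0 < s * v" "0 < (of_int (s\<^sup>2 * v) :: real)"
    using assms(1,2) by simp_all
  have "x * \<bar>y\<bar> = of_int (s\<^sup>2 * v)"
  proof -
    have "x * \<bar>y\<bar> = \<bar>x * y\<bar>"
      using assms(4) by (simp add: abs_mult)
    then show ?thesis
      unfolding prod using assms(3) abs_of_pos[OF sv(2)]
      by (auto simp del: of_int_mult of_int_power)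
  qed
  moreover have "x * \<bar>y\<bar> < x * (1 / 2)"
    using small assms(4) by (intro mult_strict_left_mono)
  ultimately have x: "of_int (2 * (s\<^sup>2 * v)) < x"
    by simp
  have cancel: "2 * s * (s * v) = 2 * (s\<^sup>2 * v)" "m * (s * v) = s * v * m"
    by (simp_all add: power2_eq_square)
  from assms(3) show ?thesis
  proof
    assume "\<epsilon> = 1"
    then have "x * y < 0"
      using prod sv by simp
    then have "y < 0"
      using assms(4) by (simp add: mult_less_0_iff)
    \<comment> \<open>Here \<open>y\<close> is negative but above -1/2, so \<open>x\<close> is below
      \<open>s * v * m + 1\<close>; integrality absorbs the 1.\<close>
    have "of_int (2 * (s\<^sup>2 * v)) < (of_int (s * v * m + 1) :: real)"
      using x sum small by simp
    then have "2 * s * (s * v) \<le> m * (s * v)"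
      unfolding cancel by linarith
    then show ?thesis
      using sv \<open>\<epsilon> = 1\<close> \<open>y < 0\<close> by (auto dest: mult_right_le_imp_le)
  next
    assume "\<epsilon> = -1"
    then have "0 < x * y"
      using prod sv by simp
    then have "0 < y"
      using assms(4) by (simp add: zero_less_mult_iff)
    then have "of_int (2 * (s\<^sup>2 * v)) < (of_int (s * v * m) :: real)"
      using x sum by simp
    then have "2 * s * (s * v) < m * (s * v)"
      unfolding cancel by linarith
    then show ?thesis
      using sv \<open>\<epsilon> = -1\<close> \<open>0 < y\<close> by (auto simp: mult_less_cancel_right)
  qed
qed

text \<open>Bounds the conjugate factor of the norm from below, by twice the denominator times the
  absolute value \<open>s\<^sup>2 * v_seq v n\<close> of the norm. This is the size needed for the
  constant 1/2 in Legendre's criterion.\<close>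

lemma conjugate_error_bound:
  fixes s v m \<epsilon> :: int and y :: real
  assumes "0 < s" "0 < v"
    and cases: "\<epsilon> = 1 \<and> 2 * s \<le> m \<and> y < 0 \<or> \<epsilon> = -1 \<and> 2 * s < m \<and> 0 < y"
    and small: "\<bar>y\<bar> < 1 / 2"
  shows "2 * of_int (s\<^sup>2 * v_seq v n * a_seq v m \<epsilon> (Suc n)) <
    of_int (s * v_seq v n * a_seq v m \<epsilon> (Suc (Suc n))) - y * of_int (a_seq v m \<epsilon> (Suc n))"
proof -
  define a b c u u' where "a = a_seq v m \<epsilon> (Suc n)" and "b = a_seq v m \<epsilon> (Suc (Suc n))"
    and "c = a_seq v m \<epsilon> n" and "u = v_seq v n" and "u' = v_seq v (Suc n)"
  have "0 < a \<and> 0 \<le> c \<and> 2 * c \<le> a"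
    unfolding a_def c_def using assms by (intro a_seq_growth) auto
  then have a: "0 < a" "0 \<le> c" "2 * c \<le> a"
    by auto
  have u: "1 \<le> u" "1 \<le> u'"
    using v_seq_pos[OF assms(2), of n] v_seq_pos[OF assms(2), of "Suc n"]
    by (simp_all add: u_def u'_def)
  have b: "b = u' * m * a + \<epsilon> * c"
    by (simp add: a_def b_def c_def u'_def)
  have "m \<le> u' * m"
    using u cases assms(1) by (auto simp: mult_le_cancel_right1)
  then have ma: "m * a \<le> u' * m * a"
    using a by (intro mult_right_mono) auto
  have su: "1 \<le> s * u"
    using assms(1) u by (simp add: int_one_le_iff_zero_less)
  have "2 * of_int (s\<^sup>2 * u * a) < of_int (s * u * b) - y * of_int a"
    using cases
  proof (elim disjE conjE)
    assume *: "\<epsilon> = 1" "2 * s \<le> m" "y < 0"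
    have "2 * s * a \<le> m * a"
      using * a by (intro mult_right_mono) auto
    then have "2 * s * a \<le> b"
      using ma a b unfolding *(1) by linarith
    then have "s * u * (2 * s * a) \<le> s * u * b"
      using su by (intro mult_left_mono) auto
    then have "2 * (s\<^sup>2 * u * a) \<le> s * u * b"
      by (simp add: power2_eq_square mult.assoc mult.left_commute)
    then have "2 * of_int (s\<^sup>2 * u * a) \<le> (of_int (s * u * b) :: real)"
      by linarith
    moreover have "y * of_int a < 0"
      using * a by (simp add: mult_neg_pos)
    ultimately show ?thesis
      by linarith
  next
    assume *: "\<epsilon> = -1" "2 * s < m" "0 < y"
    have "(2 * s + 1) * a \<le> m * a"
      using * a by (intro mult_right_mono) auto
    then have "2 * s * a + a \<le> m * a"
      by (simp add: distrib_right)
    \<comment> \<open>The inequality is doubled because \<open>c\<close> is only known to be at most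
      half of \<open>a\<close>. The surplus \<open>a\<close> later pays for
      \<open>2 * y * a\<close>, as \<open>y < 1 / 2\<close>.\<close>
    then have "4 * s * a + a \<le> 2 * b"
      using ma a b unfolding *(1) by linarith
    then have "s * u * (4 * s * a + a) \<le> s * u * (2 * b)"
      using su by (intro mult_left_mono) auto
    moreover have "a \<le> s * u * a"
      using su a by (simp add: mult_le_cancel_right1)
    ultimately have "4 * (s\<^sup>2 * u * a) + a \<le> 2 * (s * u * b)"
      by (simp add: power2_eq_square algebra_simps)
    then have "4 * of_int (s\<^sup>2 * u * a) + of_int a \<le> (2 * of_int (s * u * b) :: real)"
      by linarith
    moreover have "y * of_int a < 1 / 2 * of_int a"
      using small a by (intro mult_strict_right_mono) auto
    ultimately show ?thesis
      by linarith
  qed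
  then show ?thesis
    by (simp add: a_def b_def u_def)
qed

theorem theorem4p2:
  fixes s v m \<epsilon> :: int and d k \<xi> \<xi>' :: real
  assumes "s > 0" and "v > 0" and "m > 0"
    and "\<epsilon> \<in> {1, -1}"
    and "\<not> (\<epsilon> = -1 \<and> v * m\<^sup>2 \<le> 4)"
    and "d = of_int (s * v * m) / 2"
    and "k = of_int (s\<^sup>2 * v * (v * m\<^sup>2 + 4 * \<epsilon>)) / 4"
    and "\<xi> = d + sqrt k"
    and "\<xi>' = d - sqrt k"
    and "\<bar>\<xi>'\<bar> < 1 / 2"
  shows "simple_cf (pattern_cf s v m \<epsilon>) \<and>
    (\<forall>n\<ge>1. \<exists>i. (f_xi s v m \<epsilon> ^^ n) None = Some (convergent_of \<xi> i))"
proof -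
  have eps: "\<epsilon> = 1 \<or> \<epsilon> = -1"
    using assms(4) by simp
  have "0 < v * m\<^sup>2 + 4 * \<epsilon>"
    using eps assms(2,3,5) by (auto intro: add_pos_pos)
  then have "0 < s\<^sup>2 * v * (v * m\<^sup>2 + 4 * \<epsilon>)"
    using assms(1,2) by simp
  then have "0 < k"
    unfolding assms(7) by (simp only: of_int_0_less_iff zero_less_divide_iff) simp
  have sum: "\<xi> + \<xi>' = of_int (s * v * m)"
    by (simp add: assms(6,8,9))
  have "\<xi> * \<xi>' = d\<^sup>2 - (sqrt k)\<^sup>2"
    unfolding assms(8,9) by (simp add: power2_eq_square algebra_simps)
  also have "\<dots> = d\<^sup>2 - k"
    using \<open>0 < k\<close> by simp
  also have "\<dots> = - of_int (\<epsilon> * s\<^sup>2 * v)"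
    unfolding assms(6,7) by (simp add: power2_eq_square field_simps)
  finally have prod: "\<xi> * \<xi>' = - of_int (\<epsilon> * s\<^sup>2 * v)" .
  have "0 < d"
    using assms(1-3) by (simp add: assms(6))
  then have "0 < \<xi>"
    unfolding assms(8) using \<open>0 < k\<close> by (simp add: add_pos_pos)
  have cases: "\<epsilon> = 1 \<and> 2 * s \<le> m \<and> \<xi>' < 0 \<or> \<epsilon> = -1 \<and> 2 * s < m \<and> 0 < \<xi>'"
    using assms(1,2) eps \<open>0 < \<xi>\<close> sum prod assms(10) by (rule small_conjugate_imp_large_m)

  have "simple_cf (pattern_cf s v m \<epsilon>)"
    unfolding pattern_cf_def
  proof (rule simple_cf_flat)
    show "E_block s v m \<epsilon> n \<noteq> []" for n
      using is_finite_cf_E_block[OF assms(1)] by (auto simp: is_finite_cf_iff)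
    show "\<forall>c\<in>set (tl (E_block s v m \<epsilon> 0)). 0 < c"
      using is_finite_cf_E_block[OF assms(1), of v m \<epsilon> 0] by (force simp: is_finite_cf_iff)
    fix n :: nat and c assume n: "1 \<le> n" "c \<in> set (E_block s v m \<epsilon> n)"
    then have "is_finite_cf (E_block s v m \<epsilon> n) (xi_hat s v m \<epsilon> n - delta \<epsilon>)"
      using is_finite_cf_E_block[OF assms(1), of v m \<epsilon> n] by simp
    moreover have "1 < xi_hat s v m \<epsilon> n - delta \<epsilon>"
      using assms(1,2) cases by (intro xi_hat_gt_one) auto
    ultimately show "0 < c"
      using is_finite_cf_pos n(2) by force
  qed
  moreover have "\<exists>i. (f_xi s v m \<epsilon> ^^ n) None = Some (convergent_of \<xi> i)" if n1: "n \<ge> 1" for n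
  proof -
    obtain j where n: "n = Suc j"
      using n1 by (cases n) auto
    have apos: "0 < a_seq v m \<epsilon> (Suc i)" for i
      using a_seq_growth[of v m \<epsilon> i] assms(1,2) cases by auto
    \<comment> \<open>\<open>p/q\<close> is the iterate in question; \<open>u\<close> equals
      \<open>v_seq v (Suc n)\<close>, since \<open>v_seq\<close> has period 2.\<close>
    define q u p where "q = a_seq v m \<epsilon> n" and "u = v_seq v j"
      and "p = s * v_seq v j * a_seq v m \<epsilon> (Suc n)"
    have "0 < q"
      unfolding q_def n by (rule apos)
    have "0 < u"
      unfolding u_def using assms(2) by (rule v_seq_pos)
    have bound: "2 * of_int (s\<^sup>2 * u * q) < of_int p - \<xi>' * of_int q"
      using conjugate_error_bound[OF assms(1,2) cases assms(10), of j]
      by (simp add: p_def q_def u_def n)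
    have norm: "\<bar>of_int p - \<xi> * of_int q\<bar> * \<bar>of_int p - \<xi>' * of_int q\<bar> = of_int (s\<^sup>2 * u)"
    proof -
      define b where "b = a_seq v m \<epsilon> (Suc n)"
      have v: "v = u * v_seq v n"
        by (simp add: u_def n v_seq_mult_Suc)
      have "u * b\<^sup>2 - v * m * q * b - \<epsilon> * v_seq v n * q\<^sup>2 = (- \<epsilon>) ^ n"
        using a_seq_norm[of \<epsilon> v n m] eps by (auto simp: q_def b_def u_def n v_seq_Suc_Suc)
      then have "s\<^sup>2 * u * (u * b\<^sup>2 - v * m * q * b - \<epsilon> * v_seq v n * q\<^sup>2) = s\<^sup>2 * u * (- \<epsilon>) ^ n"
        by simp
      moreover have "s\<^sup>2 * u * (u * b\<^sup>2 - v * m * q * b - \<epsilon> * v_seq v n * q\<^sup>2) =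
          p\<^sup>2 - s * v * m * (p * q) - \<epsilon> * s\<^sup>2 * (u * v_seq v n) * q\<^sup>2"
        by (simp add: p_def b_def u_def power2_eq_square algebra_simps)
      ultimately have *: "p\<^sup>2 - s * v * m * (p * q) - \<epsilon> * s\<^sup>2 * v * q\<^sup>2 = s\<^sup>2 * u * (- \<epsilon>) ^ n"
        using v by simp
      have "(of_int p - \<xi> * of_int q) * (of_int p - \<xi>' * of_int q) =
          (of_int p)\<^sup>2 - (\<xi> + \<xi>') * (of_int p * of_int q) + \<xi> * \<xi>' * (of_int q)\<^sup>2"
        by (simp add: power2_eq_square algebra_simps)
      also have "\<dots> = of_int (p\<^sup>2 - s * v * m * (p * q) - \<epsilon> * s\<^sup>2 * v * q\<^sup>2)"
        unfolding sum prod by simp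
      also have "\<dots> = of_int (s\<^sup>2 * u * (- \<epsilon>) ^ n)"
        unfolding * ..
      finally have "\<bar>(of_int p - \<xi> * of_int q) * (of_int p - \<xi>' * of_int q)\<bar> =
          \<bar>of_int (s\<^sup>2 * u * (- \<epsilon>) ^ n)\<bar>"
        by simp
      also have "\<dots> = of_int (s\<^sup>2 * u)"
        using eps \<open>0 < u\<close> by (auto simp: abs_mult power_abs)
      finally show ?thesis
        by (simp add: abs_mult)
    qed
    have su: "0 < (of_int (s\<^sup>2 * u) :: real)"
      using assms(1) \<open>0 < u\<close> by simp
    \<comment> \<open>The norm does not vanish, so neither does its first factor. Legendre's
      criterion and the strict multiplication below both rely on this.\<close>
    then have ne: "of_int p \<noteq> \<xi> * of_int q"
      using norm by auto
    \<comment> \<open>Replacing the conjugate factor of the norm by its lower bound leaves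
      \<open>s\<^sup>2 * u\<close> on both sides, where it cancels.\<close>
    have "of_int (s\<^sup>2 * u) * (2 * of_int q * \<bar>of_int p - \<xi> * of_int q\<bar>) =
        \<bar>of_int p - \<xi> * of_int q\<bar> * (2 * of_int (s\<^sup>2 * u * q))"
      by simp
    also have "\<dots> < \<bar>of_int p - \<xi> * of_int q\<bar> * \<bar>of_int p - \<xi>' * of_int q\<bar>"
      using bound ne by (intro mult_strict_left_mono) auto
    also have "\<dots> = of_int (s\<^sup>2 * u) * 1"
      using norm by simp
    finally have "2 * of_int q * \<bar>of_int p - \<xi> * of_int q\<bar> < 1"
      using su by (simp only: mult_less_cancel_left_pos)
    then have "of_int q * \<bar>of_int p - \<xi> * of_int q\<bar> < 1 / 2"
      by simp
    from Legendre_convergent[OF \<open>0 < q\<close> ne this]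
    obtain i where "of_int p / of_int q = convergent_of \<xi> i" ..
    then have "(f_xi s v m \<epsilon> ^^ n) None = Some (convergent_of \<xi> i)"
      using f_xi_iterate[OF assms(1,2) apos, of j] unfolding p_def q_def n by simp
    then show ?thesis ..
  qed
  ultimately show ?thesis
    by blast
qed

end
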